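(* Let $(u,\lambda)\in V\times Q$ be the solution of the primal problem: $\langle Au,v\rangle+\langle Bv,\lambda\rangle=\langle f,v\rangle$ for all $v\in V$; $\langle g,q\rangle-\langle Bu,q\rangle\ge 0$ for all $q\in M$; $\lambda\in M$; $\langle g-Bu,\lambda\rangle=0$. Let $\lambda_n^{\rm pr}\in M_n$ be the multiplier component of the solution of the reduced primal problem, let $s_n\in M'$ be the reduced dual (slack) approximation, and let $u_n^{\rm du}=B^{-1}(g-s_n)\in V$ (all as defined in the context). Define the residual $r\in V'$ by $$r(v):=\langle f,v\rangle-\langle Au_n^{\rm du},v\rangle-\langle Bv,\lambda_n^{\rm pr}\rangle,\qquad v\in V,$$ and let $$\tilde d_1:=\frac{\|r\|_{V'}}{2\alpha},\qquad \tilde d_2:=\frac{\langle s_n,\lambda_n^{\rm pr}\rangle}{\alpha}.$$ Then $$\|u-u_n^{\rm du}\|_V\le\tilde\Delta_u^{\rm pr,du}:=\tilde d_1+\sqrt{\tilde d_1^2+\tilde d_2},$$ $$\|\lambda-\lambda_n^{\rm pr}\|_Q\le\tilde\Delta_\lambda^{\rm pr,du}:=\frac1\beta\Big(\|r\|_{V'}+\gamma\,\tilde\Delta_u^{\rm pr,du}\Big).$$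
   Context: Spaces. $\Omega\subset\mathbb R^d$, $d\in\{1,2,3\}$, is a bounded Lipschitz domain. $V,Q\subset L^2(\Omega)$ are real finite-dimensional Hilbert spaces (a high-fidelity "truth" discretization) with norms $\|\cdot\|_V,\|\cdot\|_Q$, dual spaces $V',Q'$, and bases $\{\Phi_i\}_{i=1}^{N_V}$ of $V$ and $\{\Psi_j\}_{j=1}^{N_Q}$ of $Q$; $\langle\cdot,\cdot\rangle$ denotes duality pairings and $\|\cdot\|_{V'}$ is the dual norm. The $\Psi_j$ are nonnegative functions such that the cone $M:=\{q\in Q: q\ge 0\text{ a.e. in }\Omega\}$ equals $\{\sum_j c_j\Psi_j: c_j\ge 0\}$. Put $M':=\{\zeta\in Q':\langle\zeta,q\rangle\ge 0\ \forall q\in M\}$. Operators. $A:V\to V'$ is the linear map induced by a continuous coercive bilinear form $a$ (not necessarily symmetric), $\langle Av,w\rangle=a(v,w)$, with continuity and coercivity constants $$\gamma=\sup_{w\in V}\sup_{v\in V}\frac{\langle Aw,v\rangle}{\|w\|_V\|v\|_V}<\infty,\qquad \alpha=\inf_{v\in V}\frac{\langle Av,v\rangle}{\|v\|_V^2}>0$$ (nonzero elements). $B:V\to Q'$ is the linear map induced by a continuous bilinear form $b$ on $V\times Q$, $\langle Bv,q\rangle=b(v,q)$; $B$ is bijective (so $N_V=N_Q$), and $$\beta=\inf_{q\in Q}\sup_{v\in V}\frac{\langle Bv,q\rangle}{\|q\|_Q\|v\|_V}>0$$ (nonzero elements). $f\in V'$, $g\in Q'$. Under these assumptions the primal problem has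 a unique solution $(u,\lambda)$. Reduced primal problem. $V_n=\mathrm{span}\{\varphi_1,\dots,\varphi_{n_V}\}\subset V$ and $Q_n=\mathrm{span}\{\psi_1,\dots,\psi_{n_Q}\}\subset Q$, with linearly independent $\varphi_i\in V$ and linearly independent $\psi_j\in M$; $M_n=\{\sum_j c_j\psi_j: c_j\ge 0\}$. The spaces are assumed to satisfy $\inf_{q_n\in Q_n}\sup_{v_n\in V_n}\frac{\langle Bv_n,q_n\rangle}{\|q_n\|_Q\|v_n\|_V}>0$. The pair $(u_n^{\rm pr},\lambda_n^{\rm pr})\in V_n\times M_n$ is the (unique) solution of: $\langle Au_n^{\rm pr},v_n\rangle+\langle Bv_n,\lambda_n^{\rm pr}\rangle=\langle f,v_n\rangle$ for all $v_n\in V_n$; $\langle g,q_n\rangle-\langle Bu_n^{\rm pr},q_n\rangle\ge0$ for all $q_n\in M_n$; $\langle g-Bu_n^{\rm pr},\lambda_n^{\rm pr}\rangle=0$. Reduced dual problem. Underlined letters denote coefficient vectors and matrices: $\underline A_{ij}=\langle A\Phi_j,\Phi_i\rangle$, $\underline B_{kj}=\langle B\Phi_j,\Psi_k\rangle$, $\underline f_i=\langle f,\Phi_i\rangle$, $\underline g_k=\langle g,\Psi_k\rangle$. Set $\underline{\tilde A}:=\underline B^{-T}\underline A\,\underline B^{-1}$ and $\underline{\tilde f}:=\underline B^{-T}\underline A\,\underline B^{-1}\underline g-\underline B^{-T}\underline f$. Let $\underline\zeta_1,\dots,\underline\zeta_{n_S}\in\mathbb R_+^{N_Q}$ be linearly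 independent ($\mathbb R_+=[0,\infty)$) and $\underline S_n:=\{\sum_i c_i\underline\zeta_i: c_i\ge0\}$. The vector $\underline s_n\in\underline S_n$ is the unique solution of the variational inequality $$(\underline\xi_n-\underline s_n)^T\underline{\tilde A}\,\underline s_n\ge(\underline\xi_n-\underline s_n)^T\underline{\tilde f}\qquad\forall\,\underline\xi_n\in\underline S_n .$$ The functional $s_n\in M'$ is determined by $\langle s_n,\Psi_j\rangle=\underline s_{n,j}$, $1\le j\le N_Q$. The dual approximation of $u$ is $u_n^{\rm du}=\sum_i\underline u^{\rm du}_{n,i}\Phi_i$ with $\underline u_n^{\rm du}:=\underline B^{-1}(\underline g-\underline s_n)$; equivalently $u_n^{\rm du}=B^{-1}(g-s_n)$. *)

theory Defs
  imports "HOL-Analysis.Analysis"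
begin

text \<open>Near each boundary point, after a rotation whose last axis is \<open>e\<close>, the set lies strictly above
  the graph of a Lipschitz function of the remaining coordinates.\<close>

definition lipschitz_domain :: "'a::euclidean_space set \<Rightarrow> bool" where
  "lipschitz_domain \<Omega> \<longleftrightarrow> open \<Omega> \<and> connected \<Omega> \<and> \<Omega> \<noteq> {} \<and>
     (\<forall>x\<in>frontier \<Omega>. \<exists>U e C h. open U \<and> x \<in> U \<and> norm e = 1 \<and>
        C-lipschitz_on {z. z \<bullet> e = 0} h \<and>
        \<Omega> \<inter> U = {y \<in> U. h (y - (y \<bullet> e) *\<^sub>R e) < y \<bullet> e})"

text \<open>A finite-dimensional Hilbert space contained in \<open>L\<^sup>2(\<Omega>)\<close>, but carrying its own inner product, is
  a type \<open>'v\<close> of class \<open>euclidean_space\<close> with a map \<open>J\<close> picking a representative function for each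
  element. Elements of \<open>L\<^sup>2(\<Omega>)\<close> are classes modulo null sets, so linearity and injectivity are
  required almost everywhere only.\<close>

definition L2_realization ::
  "'a::euclidean_space set \<Rightarrow> ('v::real_vector \<Rightarrow> 'a \<Rightarrow> real) \<Rightarrow> bool" where
  "L2_realization \<Omega> J \<longleftrightarrow>
     (\<forall>v. J v \<in> borel_measurable (lebesgue_on \<Omega>) \<and> integrable (lebesgue_on \<Omega>) (\<lambda>x. (J v x)\<^sup>2)) \<and>
     (\<forall>v w. AE x in lebesgue_on \<Omega>. J (v + w) x = J v x + J w x) \<and>
     (\<forall>c v. AE x in lebesgue_on \<Omega>. J (c *\<^sub>R v) x = c * J v x) \<and>
     (\<forall>v. (AE x in lebesgue_on \<Omega>. J v x = 0) \<longrightarrow> v = 0)"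

definition nonneg_cone :: "'a::euclidean_space set \<Rightarrow> ('q \<Rightarrow> 'a \<Rightarrow> real) \<Rightarrow> 'q set" where
  "nonneg_cone \<Omega> J = {q. AE x in lebesgue_on \<Omega>. 0 \<le> J q x}"

definition dual_cone :: "'q::real_normed_vector set \<Rightarrow> ('q \<Rightarrow>\<^sub>L real) set" where
  "dual_cone M = {\<zeta>. \<forall>q\<in>M. 0 \<le> blinfun_apply \<zeta> q}"

definition conic_combinations :: "('k \<Rightarrow> 'a::real_vector) \<Rightarrow> 'k set \<Rightarrow> 'a set" where
  "conic_combinations x I = {\<Sum>i\<in>I. c i *\<^sub>R x i | c. \<forall>i\<in>I. 0 \<le> c i}"

definition lin_indep_family :: "('k \<Rightarrow> 'a::real_vector) \<Rightarrow> 'k set \<Rightarrow> bool" where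
  "lin_indep_family x I \<longleftrightarrow> inj_on x I \<and> independent (x ` I)"

definition basis_family :: "('k \<Rightarrow> 'a::real_vector) \<Rightarrow> bool" where
  "basis_family x \<longleftrightarrow> lin_indep_family x UNIV \<and> span (range x) = UNIV"

definition induced_op ::
  "('v \<Rightarrow> 'w \<Rightarrow> real) \<Rightarrow> 'v::real_normed_vector \<Rightarrow> ('w::real_normed_vector \<Rightarrow>\<^sub>L real)" where
  "induced_op a v = Blinfun (a v)"

lemma induced_op_apply:
  assumes "bounded_bilinear a"
  shows "blinfun_apply (induced_op a v) w = a v w"
  unfolding induced_op_def
  by (simp add: bounded_linear_Blinfun_apply bounded_bilinear.bounded_linear_right[OF assms])

text \<open>Suprema and infima are real-valued: for forms that are bounded bilinear, the sets
  below are nonempty and bounded as long as the spaces contain nonzero vectors.\<close>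

definition continuity_const :: "('v::real_normed_vector \<Rightarrow> ('v \<Rightarrow>\<^sub>L real)) \<Rightarrow> real" where
  "continuity_const A =
     (SUP w\<in>UNIV - {0}. SUP v\<in>UNIV - {0}. blinfun_apply (A w) v / (norm w * norm v))"

definition coercivity_const :: "('v::real_normed_vector \<Rightarrow> ('v \<Rightarrow>\<^sub>L real)) \<Rightarrow> real" where
  "coercivity_const A = (INF v\<in>UNIV - {0}. blinfun_apply (A v) v / (norm v)\<^sup>2)"

definition infsup_const ::
  "('v::real_normed_vector \<Rightarrow> ('q::real_normed_vector \<Rightarrow>\<^sub>L real)) \<Rightarrow> 'v set \<Rightarrow> 'q set \<Rightarrow> real" where
  "infsup_const B W P =
     (INF q\<in>P - {0}. SUP v\<in>W - {0}. blinfun_apply (B v) q / (norm q * norm v))"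

definition primal_solution ::
  "('v::real_normed_vector \<Rightarrow> ('v \<Rightarrow>\<^sub>L real)) \<Rightarrow> ('v \<Rightarrow> ('q::real_normed_vector \<Rightarrow>\<^sub>L real)) \<Rightarrow>
   ('v \<Rightarrow>\<^sub>L real) \<Rightarrow> ('q \<Rightarrow>\<^sub>L real) \<Rightarrow> 'v set \<Rightarrow> 'q set \<Rightarrow> 'v \<Rightarrow> 'q \<Rightarrow> bool" where
  "primal_solution A B f g W K u l \<longleftrightarrow>
     u \<in> W \<and> l \<in> K \<and>
     (\<forall>v\<in>W. blinfun_apply (A u) v + blinfun_apply (B v) l = blinfun_apply f v) \<and>
     (\<forall>q\<in>K. 0 \<le> blinfun_apply g q - blinfun_apply (B u) q) \<and>
     blinfun_apply (g - B u) l = 0"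

text \<open>Coefficient matrices: the row index belongs to the test function.\<close>

definition op_matrix ::
  "('v \<Rightarrow> ('w::real_normed_vector \<Rightarrow>\<^sub>L real)) \<Rightarrow> ('i \<Rightarrow> 'v) \<Rightarrow> ('j \<Rightarrow> 'w) \<Rightarrow> real^'i^'j" where
  "op_matrix T x y = (\<chi> k j. blinfun_apply (T (x j)) (y k))"

definition functional_vec ::
  "('w::real_normed_vector \<Rightarrow>\<^sub>L real) \<Rightarrow> ('j \<Rightarrow> 'w) \<Rightarrow> real^'j" where
  "functional_vec l y = (\<chi> k. blinfun_apply l (y k))"

text \<open>In the next two definitions \<open>Am\<close>, \<open>Bm\<close> are the matrices of the operators and \<open>fv\<close>, \<open>gv\<close> the
  vectors of the functionals. The matrix \<open>Bm\<close> is indexed by two different types;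
  \<open>matrix_inv\<close> is still its two-sided inverse, since bijectivity of the operator forces
  both types to have the same cardinality.\<close>

definition dual_matrix :: "real^'i^'i \<Rightarrow> real^'i^'j \<Rightarrow> real^'j^'j" where
  "dual_matrix Am Bm = transpose (matrix_inv Bm) ** Am ** matrix_inv Bm"

definition dual_rhs :: "real^'i^'i \<Rightarrow> real^'i^'j \<Rightarrow> real^'i \<Rightarrow> real^'j \<Rightarrow> real^'j" where
  "dual_rhs Am Bm fv gv =
     (transpose (matrix_inv Bm) ** Am ** matrix_inv Bm) *v gv - transpose (matrix_inv Bm) *v fv"

definition vi_solution :: "real^'j^'j \<Rightarrow> real^'j \<Rightarrow> (real^'j) set \<Rightarrow> real^'j \<Rightarrow> bool" where
  "vi_solution At ft S s \<longleftrightarrow>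
     s \<in> S \<and> (\<forall>\<xi>\<in>S. (\<xi> - s) \<bullet> (At *v s) \<ge> (\<xi> - s) \<bullet> ft)"

definition residual ::
  "('v::real_normed_vector \<Rightarrow> ('v \<Rightarrow>\<^sub>L real)) \<Rightarrow> ('v \<Rightarrow> ('q::real_normed_vector \<Rightarrow>\<^sub>L real)) \<Rightarrow>
   ('v \<Rightarrow>\<^sub>L real) \<Rightarrow> 'v \<Rightarrow> 'q \<Rightarrow> ('v \<Rightarrow>\<^sub>L real)" where
  "residual A B f w l =
     Blinfun (\<lambda>v. blinfun_apply f v - blinfun_apply (A w) v - blinfun_apply (B v) l)"

lemma residual_apply:
  assumes "bounded_bilinear b"
  shows "blinfun_apply (residual A (induced_op b) f w l) v =
    blinfun_apply f v - blinfun_apply (A w) v - b v l"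
proof -
  have "bounded_linear (\<lambda>v. blinfun_apply f v - blinfun_apply (A w) v - b v l)"
    by (intro bounded_linear_sub blinfun.bounded_linear_right
        bounded_bilinear.bounded_linear_left[OF assms])
  then show ?thesis
    by (simp add: residual_def induced_op_apply[OF assms] bounded_linear_Blinfun_apply)
qed

lemma nonneg_coeffs_in_dual_cone:
  assumes "M = conic_combinations \<Psi> UNIV"
    and "\<forall>j. blinfun_apply s (\<Psi> j) = sv $ j" and "\<forall>j. 0 \<le> sv $ j"
  shows "s \<in> dual_cone M"
  using assms
  by (auto simp: dual_cone_def conic_combinations_def blinfun.sum_right blinfun.scaleR_right
      intro!: sum_nonneg)

end

theory Submission imports Defs begin

text \<open>Write \<open>e = u - u_du\<close> and \<open>\<sigma> = g - B u\<close>. The residual splits as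
  \<open>r(v) = \<langle>A e, v\<rangle> + \<langle>B v, l - l_pr\<rangle>\<close>, and \<open>B e = s - \<sigma>\<close>. Testing with \<open>v = e\<close>, the signs
  \<open>\<langle>s, l\<rangle> \<ge> 0\<close>, \<open>\<langle>\<sigma>, l_pr\<rangle> \<ge> 0\<close> and complementarity \<open>\<langle>\<sigma>, l\<rangle> = 0\<close> leave the quadratic inequality
  \<open>\<alpha> \<parallel>e\<parallel>\<^sup>2 \<le> \<parallel>r\<parallel> \<parallel>e\<parallel> + \<langle>s, l_pr\<rangle>\<close>, which gives the first bound. The second follows from the
  inf-sup condition applied to \<open>\<langle>B v, l - l_pr\<rangle> = r(v) - \<langle>A e, v\<rangle>\<close>.\<close>

lemma bounded_bilinear_bound:
  assumes "bounded_bilinear b"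
  obtains K where "\<And>v q. \<bar>b v q\<bar> \<le> K * (norm q * norm v)"
proof -
  obtain K where "\<And>v q. norm (b v q) \<le> norm v * norm q * K"
    using bounded_bilinear.bounded[OF assms] by blast
  then show thesis
    using that[of K] by (auto simp: mult_ac)
qed

text \<open>A supremum of reals dominates its members only when the set is bounded above. A bound
  \<open>K\<close> of the form bounds every quotient, hence every inner supremum, so both nested
  suprema are genuine.\<close>

lemma bounded_bilinear_le_continuity_const:
  fixes a :: "'v::real_normed_vector \<Rightarrow> 'v \<Rightarrow> real"
  assumes "bounded_bilinear a"
  shows "a w v \<le> continuity_const (induced_op a) * norm w * norm v"
proof (cases "w = 0 \<or> v = 0")
  case True
  then show ?thesis
    using bounded_bilinear.zero_left[OF assms] bounded_bilinear.zero_right[OF assms] by auto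
next
  case False
  obtain K where K: "\<And>w v. \<bar>a w v\<bar> \<le> K * (norm v * norm w)"
    using bounded_bilinear_bound[OF assms] by metis
  define F where "F w v = a w v / (norm w * norm v)" for w v
  have F_le: "F w v \<le> K" if "w \<noteq> 0" "v \<noteq> 0" for w v
    using that K[of w v] by (simp add: F_def divide_simps mult_ac)
  have "F w v \<le> (SUP v\<in>UNIV - {0}. F w v)"
    using False F_le by (intro cSUP_upper) (auto intro!: bdd_aboveI[of _ K])
  also have "\<dots> \<le> (SUP w\<in>UNIV - {0}. SUP v\<in>UNIV - {0}. F w v)"
    using False F_le
    by (intro cSUP_upper) (auto intro!: bdd_aboveI[of _ K] cSUP_least)
  also have "\<dots> = continuity_const (induced_op a)"
    by (simp add: continuity_const_def F_def induced_op_apply[OF assms])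
  finally show ?thesis
    using False by (simp add: F_def divide_simps mult_ac)
qed

lemma coercivity_const_le:
  fixes a :: "'v::real_normed_vector \<Rightarrow> 'v \<Rightarrow> real"
  assumes "bounded_bilinear a"
  shows "coercivity_const (induced_op a) * (norm v)\<^sup>2 \<le> a v v"
proof (cases "v = 0")
  case True
  then show ?thesis
    using bounded_bilinear.zero_left[OF assms] by simp
next
  case False
  obtain K where K: "\<And>w v. \<bar>a w v\<bar> \<le> K * (norm v * norm w)"
    using bounded_bilinear_bound[OF assms] by metis
  have "- K \<le> a v v / (norm v)\<^sup>2" if "v \<noteq> 0" for v
    using that K[of v v] by (simp add: divide_simps power2_eq_square)
  then have "(INF v\<in>UNIV - {0}. a v v / (norm v)\<^sup>2) \<le> a v v / (norm v)\<^sup>2"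
    using False by (intro cINF_lower) (auto intro!: bdd_belowI[of _ "- K"])
  then show ?thesis
    using False by (simp add: coercivity_const_def induced_op_apply[OF assms] divide_simps)
qed

text \<open>This is how the inf-sup condition is applied: for this \<open>q\<close> the supremum
  over \<open>v\<close> is at most \<open>C / norm q\<close>, and the infimum over all nonzero
  vectors is no larger.\<close>

lemma infsup_const_le:
  fixes b :: "'v::euclidean_space \<Rightarrow> 'q::real_normed_vector \<Rightarrow> real"
  assumes "bounded_bilinear b" and bound: "\<And>v. b v q \<le> C * norm v"
  shows "infsup_const (induced_op b) UNIV UNIV * norm q \<le> C"
proof (cases "q = 0")
  case True
  \<comment> \<open>The claim reduces to 0 \<le> \<open>C\<close>, which the bound at any unit
    vector gives.\<close>
  obtain v :: 'v where "norm v = 1"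
    using vector_choose_size[of 1] by auto
  then show ?thesis
    using bound[of v] True bounded_bilinear.zero_right[OF assms(1)] by simp
next
  case False
  obtain K where K: "\<And>v q. \<bar>b v q\<bar> \<le> K * (norm q * norm v)"
    using bounded_bilinear_bound[OF assms(1)] by metis
  obtain v0 :: 'v where v0: "norm v0 = 1"
    using vector_choose_size[of 1] by auto
  then have v0_mem: "v0 \<in> UNIV - {0}"
    by auto
  define F where "F q v = b v q / (norm q * norm v)" for q v
  have F_abs: "\<bar>F q v\<bar> \<le> K" if "q \<noteq> 0" "v \<noteq> 0" for q v
    using that K[of v q] by (simp add: F_def divide_simps)
  \<comment> \<open>The infimum is a true lower bound only if the inner suprema are bounded below
    uniformly in \<open>q\<close>; the single direction \<open>v0\<close> suffices for that.\<close>
  have "- K \<le> (SUP v\<in>UNIV - {0}. F q v)" if "q \<noteq> 0" for q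
  proof -
    have "- K \<le> F q v0"
      using F_abs[of q v0] that v0_mem by auto
    also have "\<dots> \<le> (SUP v\<in>UNIV - {0}. F q v)"
      using v0_mem F_abs[OF that]
      by (intro cSUP_upper) (auto simp: abs_le_iff intro!: bdd_aboveI[of _ K])
    finally show ?thesis .
  qed
  then have "(INF q\<in>UNIV - {0}. SUP v\<in>UNIV - {0}. F q v) \<le> (SUP v\<in>UNIV - {0}. F q v)"
    using False by (intro cINF_lower) (auto intro!: bdd_belowI[of _ "- K"])
  also have "\<dots> \<le> C / norm q"
  proof (rule cSUP_least)
    show "UNIV - {0 :: 'v} \<noteq> {}"
      using v0_mem by blast
    show "F q v \<le> C / norm q" if "v \<in> UNIV - {0}" for v
      using that False bound[of v] by (simp add: F_def divide_simps mult_ac)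
  qed
  also have "(INF q\<in>UNIV - {0}. SUP v\<in>UNIV - {0}. F q v) = infsup_const (induced_op b) UNIV UNIV"
    by (simp add: infsup_const_def F_def induced_op_apply[OF assms(1)])
  finally show ?thesis
    using False by (simp add: divide_simps)
qed

text \<open>Serves two cones: the reduced multipliers, tested with \<open>g - B u\<close>, and the
  reduced slacks, tested with coordinate functionals.\<close>

lemma linear_nonneg_on_conic_combinations:
  fixes h :: "'a::real_vector \<Rightarrow> real"
  assumes "linear h" "\<And>i. i \<in> I \<Longrightarrow> 0 \<le> h (x i)" "y \<in> conic_combinations x I"
  shows "0 \<le> h y"
  using assms(2,3)
  by (auto simp: conic_combinations_def linear_sum[OF assms(1)] linear_scale[OF assms(1)]
      intro!: sum_nonneg)

text \<open>Completing the square; the assumption itself forces a nonnegative radicand.\<close>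

lemma quadratic_bound:
  fixes x d e :: real
  assumes "x\<^sup>2 \<le> 2 * d * x + e"
  shows "x \<le> d + sqrt (d\<^sup>2 + e)"
proof -
  have "(x - d)\<^sup>2 \<le> d\<^sup>2 + e"
    using assms by (simp add: power2_diff algebra_simps)
  then show ?thesis
    using real_le_rsqrt by fastforce
qed

theorem proposition4p3:
  fixes \<Omega> :: "(real^'d) set"
    and JV :: "'v::euclidean_space \<Rightarrow> real^'d \<Rightarrow> real"
    and JQ :: "'q::euclidean_space \<Rightarrow> real^'d \<Rightarrow> real"
    and \<Phi> :: "'i::finite \<Rightarrow> 'v" and \<Psi> :: "'j::finite \<Rightarrow> 'q"
    and M :: "'q set"
    and a :: "'v \<Rightarrow> 'v \<Rightarrow> real" and b :: "'v \<Rightarrow> 'q \<Rightarrow> real"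
    and A :: "'v \<Rightarrow> ('v \<Rightarrow>\<^sub>L real)" and B :: "'v \<Rightarrow> ('q \<Rightarrow>\<^sub>L real)"
    and f :: "'v \<Rightarrow>\<^sub>L real" and g :: "'q \<Rightarrow>\<^sub>L real"
    and \<alpha> \<beta> \<gamma> :: real
    and nV nQ nS :: nat
    and \<phi> :: "nat \<Rightarrow> 'v" and \<psi> :: "nat \<Rightarrow> 'q" and \<zeta> :: "nat \<Rightarrow> real^'j"
    and u u_pr u_du :: 'v and l l_pr :: 'q
    and s_vec :: "real^'j" and s :: "'q \<Rightarrow>\<^sub>L real"
    and r :: "'v \<Rightarrow>\<^sub>L real"
    and d1 d2 \<Delta>u \<Delta>l :: real
  assumes dim: "CARD('d) \<in> {1, 2, 3}"
    and domain: "bounded \<Omega>" "lipschitz_domain \<Omega>"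
    and spaces: "L2_realization \<Omega> JV" "L2_realization \<Omega> JQ"
    and bases: "basis_family \<Phi>" "basis_family \<Psi>"
    and M_def: "M = nonneg_cone \<Omega> JQ"
    and M_cone: "\<forall>j. \<Psi> j \<in> M" "M = conic_combinations \<Psi> UNIV"
    and forms: "bounded_bilinear a" "bounded_bilinear b"
    and ops: "A = induced_op a" "B = induced_op b" "bij B"
    and gamma: "\<gamma> = continuity_const A"
    and alpha: "\<alpha> = coercivity_const A" "\<alpha> > 0"
    and beta: "\<beta> = infsup_const B UNIV UNIV" "\<beta> > 0"
    and primal: "primal_solution A B f g UNIV M u l"
    and reduced_dims: "1 \<le> nV" "1 \<le> nQ"
    and phi: "lin_indep_family \<phi> {1..nV}"
    and psi: "lin_indep_family \<psi> {1..nQ}" "\<forall>j\<in>{1..nQ}. \<psi> j \<in> M"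
    and reduced_infsup: "infsup_const B (span (\<phi> ` {1..nV})) (span (\<psi> ` {1..nQ})) > 0"
    and reduced_primal:
      "primal_solution A B f g (span (\<phi> ` {1..nV})) (conic_combinations \<psi> {1..nQ}) u_pr l_pr"
    and zeta: "lin_indep_family \<zeta> {1..nS}" "\<forall>i\<in>{1..nS}. \<forall>j. 0 \<le> \<zeta> i $ j"
    and reduced_dual:
      "vi_solution (dual_matrix (op_matrix A \<Phi> \<Phi>) (op_matrix B \<Phi> \<Psi>))
         (dual_rhs (op_matrix A \<Phi> \<Phi>) (op_matrix B \<Phi> \<Psi>) (functional_vec f \<Phi>) (functional_vec g \<Psi>))
         (conic_combinations \<zeta> {1..nS}) s_vec"
    and slack: "\<forall>j. blinfun_apply s (\<Psi> j) = s_vec $ j"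
    and u_du: "u_du = inv B (g - s)"
    and r: "r = residual A B f u_du l_pr"
    and d1: "d1 = norm r / (2 * \<alpha>)"
    and d2: "d2 = blinfun_apply s l_pr / \<alpha>"
    and Delta_u: "\<Delta>u = d1 + sqrt (d1\<^sup>2 + d2)"
    and Delta_l: "\<Delta>l = 1 / \<beta> * (norm r + \<gamma> * \<Delta>u)"
  shows "norm (u - u_du) \<le> \<Delta>u \<and> norm (l - l_pr) \<le> \<Delta>l"
proof -
  have A_apply: "blinfun_apply (A v) w = a v w" for v w
    by (simp add: ops(1) induced_op_apply[OF forms(1)])
  have B_apply: "blinfun_apply (B v) q = b v q" for v q
    by (simp add: ops(2) induced_op_apply[OF forms(2)])
  note a_diff = bounded_bilinear.diff_left[OF forms(1)]
  note b_diff_left = bounded_bilinear.diff_left[OF forms(2)]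
  note b_diff_right = bounded_bilinear.diff_right[OF forms(2)]

  define e where "e = u - u_du"
  define p where "p = l - l_pr"

  have l_M: "l \<in> M"
    and primal_eq: "\<And>v. a u v + b v l = blinfun_apply f v"
    and primal_ineq: "\<And>q. q \<in> M \<Longrightarrow> 0 \<le> blinfun_apply (g - B u) q"
    and primal_compl: "blinfun_apply (g - B u) l = 0"
    using primal by (auto simp: primal_solution_def A_apply B_apply blinfun.diff_left)

  have l_pr_cone: "l_pr \<in> conic_combinations \<psi> {1..nQ}"
    using reduced_primal by (simp add: primal_solution_def)
  have sigma_l_pr: "0 \<le> blinfun_apply (g - B u) l_pr"
    using psi(2) primal_ineq
    by (intro linear_nonneg_on_conic_combinations[OF _ _ l_pr_cone,
          where h = "blinfun_apply (g - B u)"] bounded_linear.linear blinfun.bounded_linear_right) auto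

  have "s_vec \<in> conic_combinations \<zeta> {1..nS}"
    using reduced_dual by (simp add: vi_solution_def)
  then have "0 \<le> s_vec $ j" for j
    using linear_nonneg_on_conic_combinations[of "\<lambda>x. x $ j" "{1..nS}" \<zeta>] zeta(2)
      bounded_linear.linear[OF bounded_linear_vec_nth] by blast
  then have s_l: "0 \<le> blinfun_apply s l"
    using nonneg_coeffs_in_dual_cone[OF M_cone(2) slack] l_M by (auto simp: dual_cone_def)

  have "B u_du = g - s"
    using ops(3) by (simp add: u_du bij_is_surj surj_f_inv_f)
  then have b_e: "b e q = blinfun_apply s q - blinfun_apply (g - B u) q" for q
    using B_apply[of u q] B_apply[of u_du q] by (simp add: e_def b_diff_left blinfun.diff_left)

  have residual_split: "blinfun_apply r v = a e v + b v p" for v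
    using primal_eq[of v]
    by (simp add: r ops(2) residual_apply[OF forms(2)] A_apply e_def p_def a_diff b_diff_right)
  have r_le: "blinfun_apply r v \<le> norm r * norm v" for v
    using norm_blinfun[of r v] by simp

  \<comment> \<open>Expanded, \<open>b e p\<close> is
    \<open>s l - (g - B u) l - s l_pr + (g - B u) l_pr\<close>: the second term vanishes, the first
    and last are nonnegative.\<close>
  have "b e p \<ge> - blinfun_apply s l_pr"
    unfolding p_def b_diff_right b_e using primal_compl sigma_l_pr s_l by simp
  then have "a e e \<le> norm r * norm e + blinfun_apply s l_pr"
    using residual_split[of e] r_le[of e] by simp
  then have "\<alpha> * (norm e)\<^sup>2 \<le> norm r * norm e + blinfun_apply s l_pr"
    using coercivity_const_le[OF forms(1), of e] by (simp add: alpha(1) ops(1))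
  \<comment> \<open>Division by \<alpha>; the factor 2 in the denominator of \<open>d1\<close>
    prepares for completing the square.\<close>
  then have "(norm e)\<^sup>2 \<le> 2 * d1 * norm e + d2"
    using alpha(2) by (simp add: d1 d2 field_simps)
  then have u_bound: "norm e \<le> \<Delta>u"
    unfolding Delta_u by (rule quadratic_bound)

  have a_le: "a w v \<le> \<gamma> * norm w * norm v" for w v
    using bounded_bilinear_le_continuity_const[OF forms(1)] by (simp add: gamma ops(1))
  \<comment> \<open>The supremum defining \<gamma> has no absolute values, so its sign comes from
    coercivity: \<gamma> \<ge> \<open>a v v\<close> \<ge> \<alpha> > 0 at a unit vector. It lets
    \<open>norm e\<close> be replaced by its bound under multiplication by \<gamma>.\<close>
  have gamma_nonneg: "0 \<le> \<gamma>"
  proof -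
    obtain v :: 'v where v: "norm v = 1"
      using vector_choose_size[of 1] by auto
    then have "\<alpha> \<le> a v v"
      using coercivity_const_le[OF forms(1), of v] by (simp add: alpha(1) ops(1))
    with a_le[of v v] v alpha(2) show ?thesis
      by simp
  qed
  \<comment> \<open>The continuity bound is one-sided; evaluating it at \<open>- v\<close> bounds
    \<open>- a e v\<close>.\<close>
  have "b v p \<le> (norm r + \<gamma> * norm e) * norm v" for v
    using residual_split[of v] r_le[of v] a_le[of e "- v"]
    by (simp add: bounded_bilinear.minus_right[OF forms(1)] algebra_simps)
  then have "\<beta> * norm p \<le> norm r + \<gamma> * norm e"
    unfolding beta(1) ops(2) by (rule infsup_const_le[OF forms(2)])
  also have "\<dots> \<le> norm r + \<gamma> * \<Delta>u"
    using u_bound gamma_nonneg by (simp add: mult_left_mono)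
  finally have "norm p \<le> \<Delta>l"
    using beta(2) by (simp add: Delta_l field_simps)
  with u_bound show ?thesis
    by (simp add: e_def p_def)
qed

end
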